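(* Let $\psi$ be a homomorphism and $B$ a joint distribution on $\mathcal H\times\mathcal A\times\mathcal S\times\mathcal B$ inducing a stochastic inverse of $\psi$. Let $\Pi:\mathcal H\to\Delta(\mathcal A)$ be a policy, $\pi_R$ a representative abstract policy of $\Pi$, and $\varepsilon,\varepsilon_B\ge0$ such that $|V^\Pi(h)-V^\Pi(h')|\le\varepsilon$ whenever $\psi(h)=\psi(h')$, and $\left|\sum_{\tilde a\in\mathcal A}Q^\Pi(h,\tilde a)B^{\pi_R}(\tilde a|hs)-V^\Pi(h)\right|\le\varepsilon_B$ for all $h$ with $s=\psi(h)$. Then for all $s\in\mathcal S$, $b\in\mathcal B$ and all $h$ with $\psi(h)=s$, $$\left|\langle Q^\Pi(\psi^{-1}(s,b))\rangle_B-q^{\pi_R}(s,b)\right|\le\frac{\gamma(\varepsilon+\varepsilon_B)}{1-\gamma}\qquad\text{and}\qquad\left|V^\Pi(h)-v^{\pi_R}(s)\right|\le\frac{\varepsilon+\varepsilon_B}{1-\gamma}.$$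
   Context: Setting. $\mathcal A$ (actions), $\mathcal O$ (observations), $\mathcal R\subseteq[0,1]$ (rewards) are finite nonempty sets; $\gamma\in[0,1)$; $\Delta(X)$ is the set of probability distributions on $X$. $\mathcal H:=\bigcup_{t\ge0}(\mathcal A\times\mathcal O\times\mathcal R)^t$ is the (countable) set of finite histories. The original process is a map $P:\mathcal H\times\mathcal A\to\Delta(\mathcal O\times\mathcal R)$, written $P(or|ha)$ (arbitrary dependence on the history). A policy is a map $\Pi:\mathcal H\to\Delta(\mathcal A)$, written $\Pi(a|h)$. Its (action-)value functions are the unique bounded functions with $Q^\Pi(h,a)=\sum_{o,r}P(or|ha)\,(r+\gamma V^\Pi(haor))$ and $V^\Pi(h)=\sum_{a}Q^\Pi(h,a)\Pi(a|h)$, where $haor$ is the history $h$ extended by $(a,o,r)$. Homomorphism. $\mathcal S$ and $\mathcal B$ are finite nonempty sets (abstract states and abstract actions). A homomorphism is a surjective map $\psi:\mathcal H\times\mathcal A\to\mathcal S\times\mathcal B$ whose state component depends only on the history: $\psi(h,a)=(f(h),b)$ for a surjective $f:\mathcal H\to\mathcal S$ (while $b$ may depend on both $h$ and $a$). Write $\psi(h)=s$ for $f(h)=s$, and, for $f(h)=s$, $\psi_s^{-1}(b):=\{a\in\mathcal A:\psi(h,a)=(s,b)\}$ (it depends on $h$). The induced abstract process is $P_\psi(s'r|ha):=\sum_{o:\psi(haor)=s'}P(or|ha)$, and the induced abstract policy is $\Pi_\psi(b|h):=\sum_{a\in\psi_s^{-1}(b)}\Pi(a|h)$ with $s=\psi(h)$.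 A representative abstract policy of $\Pi$ is $\pi_R(\cdot|s):=\Pi_\psi(\cdot|\tilde h)$ for some (arbitrarily chosen) $\tilde h$ with $\psi(\tilde h)=s$. Distribution $B$. $B$ is a probability distribution on $\mathcal H\times\mathcal A\times\mathcal S\times\mathcal B$ supported on tuples $(h,a,s,b)$ with $\psi(h,a)=(s,b)$; marginals and conditionals of it are also denoted $B$, and it is assumed that all conditionals below are defined, i.e. the marginals satisfy $B(h)>0$ for all $h$ and $B(sb)>0$ for all $(s,b)$. In particular the stochastic inverse $B(ha|sb)$ vanishes unless $\psi(h,a)=(s,b)$, and $B(ha|sb)=B(h|s)\,\frac{B(ab|h)}{B(b|s)}$ for $s=\psi(h)$. For an abstract policy $\pi:\mathcal S\to\Delta(\mathcal B)$ define $B^\pi(a|hs):=\sum_{b\in\mathcal B}\frac{B(ab|h)}{B(b|s)}\pi(b|s)$. The $B$-average is $\langle Q^\Pi(\psi^{-1}(s,b))\rangle_B:=\sum_{h\in\mathcal H,a\in\mathcal A}Q^\Pi(h,a)B(ha|sb)$. Surrogate MDP. $p_B(s'r'|sb):=\sum_{h\in\mathcal H,a\in\mathcal A}P_\psi(s'r'|ha)B(ha|sb)$. For an abstract policy $\pi$, $q^\pi,v^\pi$ are the solutions of $q^\pi(s,b)=\sum_{s',r}p_B(s'r|sb)(r+\gamma v^\pi(s'))$, $v^\pi(s)=\sum_bq^\pi(s,b)\pi(b|s)$. *)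

theory Defs
  imports "HOL-Probability.Probability"
begin

text \<open>
  Actions, observations, abstract states and abstract actions range over finite types; the
  rewards form a finite set \<open>R\<close> of real numbers.
  Functions on histories are total on lists; only their values on \<open>histories R\<close> are relevant.
  Value functions are therefore given by a predicate; \<open>value_functions_exist\<close>,
  \<open>value_functions_unique\<close> and their \<open>mdp_\<close> counterparts below show that it determines them,
  on \<open>histories R\<close> and on all abstract states, respectively.
\<close>

type_synonym ('a, 'o) history = "('a \<times> 'o \<times> real) list"

definition histories :: "real set \<Rightarrow> ('a, 'o) history set" where
  "histories R = lists (UNIV \<times> UNIV \<times> R)"

definition reward_set :: "real set \<Rightarrow> bool" where
  "reward_set R \<longleftrightarrow> finite R \<and> R \<noteq> {} \<and> R \<subseteq> {0..1}"

definition process ::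
  "real set \<Rightarrow> (('a, 'o) history \<Rightarrow> 'a \<Rightarrow> ('o \<times> real) pmf) \<Rightarrow> bool" where
  "process R P \<longleftrightarrow> (\<forall>h\<in>histories R. \<forall>a. set_pmf (P h a) \<subseteq> UNIV \<times> R)"

definition value_functions ::
  "real set \<Rightarrow> real \<Rightarrow> (('a::finite, 'o::finite) history \<Rightarrow> 'a \<Rightarrow> ('o \<times> real) pmf) \<Rightarrow>
   (('a, 'o) history \<Rightarrow> 'a pmf) \<Rightarrow> (('a, 'o) history \<Rightarrow> 'a \<Rightarrow> real) \<Rightarrow>
   (('a, 'o) history \<Rightarrow> real) \<Rightarrow> bool" where
  "value_functions R \<gamma> P pol Q V \<longleftrightarrow>
     bounded ((\<lambda>(h, a). Q h a) ` (histories R \<times> UNIV)) \<and>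
     bounded (V ` histories R) \<and>
     (\<forall>h\<in>histories R. \<forall>a.
        Q h a = (\<Sum>(x, r)\<in>UNIV \<times> R. pmf (P h a) (x, r) * (r + \<gamma> * V (h @ [(a, x, r)])))) \<and>
     (\<forall>h\<in>histories R. V h = (\<Sum>a\<in>UNIV. Q h a * pmf (pol h) a))"

text \<open>The map \<open>f\<close> is the state component of \<open>\<psi>\<close>, written \<open>\<psi>(h)\<close> on paper.\<close>

definition homomorphism ::
  "real set \<Rightarrow> (('a, 'o) history \<times> 'a \<Rightarrow> 's \<times> 'b) \<Rightarrow> (('a, 'o) history \<Rightarrow> 's) \<Rightarrow> bool" where
  "homomorphism R \<psi> f \<longleftrightarrow>
     \<psi> ` (histories R \<times> UNIV) = UNIV \<and>
     f ` histories R = UNIV \<and>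
     (\<forall>h\<in>histories R. \<forall>a. fst (\<psi> (h, a)) = f h)"

definition abs_process ::
  "(('a, 'o::finite) history \<Rightarrow> 'a \<Rightarrow> ('o \<times> real) pmf) \<Rightarrow> (('a, 'o) history \<Rightarrow> 's) \<Rightarrow>
   's \<Rightarrow> real \<Rightarrow> ('a, 'o) history \<Rightarrow> 'a \<Rightarrow> real" where
  "abs_process P f s' r h a = (\<Sum>x | f (h @ [(a, x, r)]) = s'. pmf (P h a) (x, r))"

definition abs_policy ::
  "(('a::finite, 'o) history \<times> 'a \<Rightarrow> 's \<times> 'b) \<Rightarrow> (('a, 'o) history \<Rightarrow> 's) \<Rightarrow>
   (('a, 'o) history \<Rightarrow> 'a pmf) \<Rightarrow> 'b \<Rightarrow> ('a, 'o) history \<Rightarrow> real" where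
  "abs_policy \<psi> f pol b h = (\<Sum>a | \<psi> (h, a) = (f h, b). pmf (pol h) a)"

definition representative_policy ::
  "real set \<Rightarrow> (('a::finite, 'o) history \<times> 'a \<Rightarrow> 's \<times> 'b) \<Rightarrow> (('a, 'o) history \<Rightarrow> 's) \<Rightarrow>
   (('a, 'o) history \<Rightarrow> 'a pmf) \<Rightarrow> ('s \<Rightarrow> 'b pmf) \<Rightarrow> bool" where
  "representative_policy R \<psi> f pol \<pi> \<longleftrightarrow>
     (\<forall>s. \<exists>h\<in>histories R. f h = s \<and> (\<forall>b. pmf (\<pi> s) b = abs_policy \<psi> f pol b h))"

definition joint_distribution ::
  "real set \<Rightarrow> (('a, 'o) history \<times> 'a \<Rightarrow> 's \<times> 'b) \<Rightarrow>
   (('a, 'o) history \<times> 'a \<times> 's \<times> 'b) pmf \<Rightarrow> bool" where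
  "joint_distribution R \<psi> B \<longleftrightarrow>
     set_pmf B \<subseteq> {(h, a, s, b). h \<in> histories R \<and> \<psi> (h, a) = (s, b)} \<and>
     (\<forall>h\<in>histories R. \<P>((h', a', s', b') in B. h' = h) > 0) \<and>
     (\<forall>s b. \<P>((h', a', s', b') in B. s' = s \<and> b' = b) > 0)"

text \<open>The stochastic inverse \<open>B(h a | s b)\<close>\<close>

definition stoch_inv ::
  "(('a, 'o) history \<times> 'a \<times> 's \<times> 'b) pmf \<Rightarrow> ('a, 'o) history \<Rightarrow> 'a \<Rightarrow> 's \<Rightarrow> 'b \<Rightarrow> real" where
  "stoch_inv B h a s b =
     cond_prob B (\<lambda>(h', a', s', b'). h' = h \<and> a' = a) (\<lambda>(h', a', s', b'). s' = s \<and> b' = b)"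

text \<open>\<open>B\<^sup>\<pi>(a | h s) = \<Sum>\<^sub>b B(a b | h) / B(b | s) * \<pi>(b | s)\<close>\<close>

definition lifted_policy ::
  "(('a, 'o) history \<times> 'a \<times> 's \<times> 'b::finite) pmf \<Rightarrow> ('s \<Rightarrow> 'b pmf) \<Rightarrow>
   'a \<Rightarrow> ('a, 'o) history \<Rightarrow> 's \<Rightarrow> real" where
  "lifted_policy B \<pi> a h s =
     (\<Sum>b\<in>UNIV.
        cond_prob B (\<lambda>(h', a', s', b'). a' = a \<and> b' = b) (\<lambda>(h', a', s', b'). h' = h) /
        cond_prob B (\<lambda>(h', a', s', b'). b' = b) (\<lambda>(h', a', s', b'). s' = s) *
        pmf (\<pi> s) b)"

definition B_average ::
  "real set \<Rightarrow> (('a, 'o) history \<times> 'a \<times> 's \<times> 'b) pmf \<Rightarrow> (('a, 'o) history \<Rightarrow> 'a \<Rightarrow> real) \<Rightarrow>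
   's \<Rightarrow> 'b \<Rightarrow> real" where
  "B_average R B Q s b = (\<Sum>\<^sub>\<infinity>(h, a)\<in>histories R \<times> UNIV. Q h a * stoch_inv B h a s b)"

definition surrogate ::
  "real set \<Rightarrow> (('a, 'o::finite) history \<Rightarrow> 'a \<Rightarrow> ('o \<times> real) pmf) \<Rightarrow> (('a, 'o) history \<Rightarrow> 's) \<Rightarrow>
   (('a, 'o) history \<times> 'a \<times> 's \<times> 'b) pmf \<Rightarrow> 's \<Rightarrow> real \<Rightarrow> 's \<Rightarrow> 'b \<Rightarrow> real" where
  "surrogate R P f B s' r s b =
     (\<Sum>\<^sub>\<infinity>(h, a)\<in>histories R \<times> UNIV. abs_process P f s' r h a * stoch_inv B h a s b)"

definition mdp_value_functions ::
  "real set \<Rightarrow> real \<Rightarrow> ('s::finite \<Rightarrow> real \<Rightarrow> 's \<Rightarrow> 'b::finite \<Rightarrow> real) \<Rightarrow> ('s \<Rightarrow> 'b pmf) \<Rightarrow>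
   ('s \<Rightarrow> 'b \<Rightarrow> real) \<Rightarrow> ('s \<Rightarrow> real) \<Rightarrow> bool" where
  "mdp_value_functions R \<gamma> p \<pi> q v \<longleftrightarrow>
     (\<forall>s b. q s b = (\<Sum>(s', r)\<in>UNIV \<times> R. p s' r s b * (r + \<gamma> * v s'))) \<and>
     (\<forall>s. v s = (\<Sum>b\<in>UNIV. q s b * pmf (\<pi> s) b))"

lemma contraction_fixpoint:
  fixes T :: "('x \<Rightarrow> real) \<Rightarrow> 'x \<Rightarrow> real"
  assumes \<gamma>: "0 \<le> \<gamma>" "\<gamma> < 1"
    and contr: "\<And>u v c x. c \<ge> 0 \<Longrightarrow> (\<And>y. y \<in> X \<Longrightarrow> \<bar>u y - v y\<bar> \<le> c) \<Longrightarrow> x \<in> X \<Longrightarrow>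
                  \<bar>T u x - T v x\<bar> \<le> \<gamma> * c"
    and bnd: "\<And>x. x \<in> X \<Longrightarrow> \<bar>T (\<lambda>_. 0) x\<bar> \<le> M" "M \<ge> 0"
  shows "\<exists>u. bounded (u ` X) \<and> (\<forall>x\<in>X. u x = T u x)"
proof -
  define w where "w n = (T ^^ n) (\<lambda>_. 0)" for n
  have w_Suc: "w (Suc n) = T (w n)" for n by (simp add: w_def)
  have step: "\<bar>w (Suc n) x - w n x\<bar> \<le> M * \<gamma> ^ n" if "x \<in> X" for n x
    using that
  proof (induction n arbitrary: x)
    case 0 then show ?case using bnd by (simp add: w_def)
  next
    case (Suc n)
    have "\<bar>T (w (Suc n)) x - T (w n) x\<bar> \<le> \<gamma> * (M * \<gamma> ^ n)"
      by (rule contr) (use Suc bnd \<gamma> in auto)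
    then show ?case by (simp add: w_Suc mult_ac)
  qed
  have geo: "(\<Sum>i<k. M * \<gamma> ^ (n + i)) \<le> M * \<gamma> ^ n / (1 - \<gamma>)" for n k
  proof -
    have "(\<Sum>i<k. M * \<gamma> ^ (n + i)) = M * \<gamma> ^ n * (\<Sum>i<k. \<gamma> ^ i)"
      by (simp add: sum_distrib_left power_add mult_ac)
    also have "(\<Sum>i<k. \<gamma> ^ i) \<le> 1 / (1 - \<gamma>)"
      using \<gamma> by (simp add: sum_gp_strict divide_right_mono)
    finally show ?thesis using \<gamma> bnd by (simp add: mult_left_mono)
  qed
  have diff: "\<bar>w (n + k) x - w n x\<bar> \<le> M * \<gamma> ^ n / (1 - \<gamma>)" if x: "x \<in> X" for n k x
  proof -
    have "\<bar>w (n + k) x - w n x\<bar> \<le> (\<Sum>i<k. M * \<gamma> ^ (n + i))"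
    proof (induction k)
      case (Suc k)
      then show ?case using step[OF x, of "n + k"] by simp
    qed simp
    then show ?thesis using geo[where n=n and k=k] by linarith
  qed
  have tail: "(\<lambda>n. M * \<gamma> ^ n / (1 - \<gamma>)) \<longlonglongrightarrow> 0"
    using \<gamma> tendsto_mult_right_zero[OF LIMSEQ_power_zero[of \<gamma>], of "M / (1 - \<gamma>)"]
    by simp
  have conv: "convergent (\<lambda>n. w n x)" if x: "x \<in> X" for x
  proof -
    have "Cauchy (\<lambda>n. w n x)"
    proof (rule metric_CauchyI)
      fix e :: real assume "e > 0"
      then obtain N where N: "M * \<gamma> ^ N / (1 - \<gamma>) < e / 2"
        using order_tendstoD(2)[OF tail, of "e / 2"] by (auto simp: eventually_sequentially)
      have near: "\<bar>w m x - w N x\<bar> < e / 2" if "m \<ge> N" for m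
      proof -
        have "\<bar>w m x - w N x\<bar> \<le> M * \<gamma> ^ N / (1 - \<gamma>)" using diff[OF x, of N "m - N"] that by simp
        then show ?thesis using N by (rule le_less_trans)
      qed
      show "\<exists>M. \<forall>m\<ge>M. \<forall>n\<ge>M. dist (w m x) (w n x) < e"
      proof (intro exI allI impI)
        fix m n assume "m \<ge> N" "n \<ge> N"
        from near[OF this(1)] near[OF this(2)] show "dist (w m x) (w n x) < e"
          unfolding dist_real_def by linarith
      qed
    qed
    then show ?thesis by (rule Cauchy_convergent)
  qed
  define u where "u x = lim (\<lambda>n. w n x)" for x
  have lim: "(\<lambda>n. w n x) \<longlonglongrightarrow> u x" if "x \<in> X" for x
    using conv[OF that] by (simp add: u_def convergent_LIMSEQ_iff)
  have close: "\<bar>u x - w n x\<bar> \<le> M * \<gamma> ^ n / (1 - \<gamma>)" if x: "x \<in> X" for x n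
  proof (rule LIMSEQ_le_const2)
    show "(\<lambda>k. \<bar>w (k + n) x - w n x\<bar>) \<longlonglongrightarrow> \<bar>u x - w n x\<bar>"
      by (intro tendsto_intros LIMSEQ_ignore_initial_segment lim x)
    show "\<exists>N. \<forall>k\<ge>N. \<bar>w (k + n) x - w n x\<bar> \<le> M * \<gamma> ^ n / (1 - \<gamma>)"
      using diff[OF x, where n = n] by (simp add: add.commute[of _ n])
  qed
  have "u x = T u x" if x: "x \<in> X" for x
  proof -
    have "\<bar>T u x - w (Suc n) x\<bar> \<le> M * \<gamma> ^ n / (1 - \<gamma>)" for n
    proof -
      have nn: "M * \<gamma> ^ n / (1 - \<gamma>) \<ge> 0" using bnd \<gamma> by simp
      have "\<bar>T u x - T (w n) x\<bar> \<le> \<gamma> * (M * \<gamma> ^ n / (1 - \<gamma>))"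
        by (rule contr[OF nn close x])
      also have "\<dots> \<le> M * \<gamma> ^ n / (1 - \<gamma>)"
        using nn \<gamma> by (intro mult_left_le_one_le) auto
      finally show ?thesis by (simp add: w_Suc)
    qed
    then have "(\<lambda>n. T u x - w (Suc n) x) \<longlonglongrightarrow> 0"
      by (intro Lim_null_comparison[OF _ tail]) auto
    moreover have "(\<lambda>n. T u x - w (Suc n) x) \<longlonglongrightarrow> T u x - u x"
      by (intro tendsto_intros LIMSEQ_Suc lim x)
    ultimately show ?thesis using LIMSEQ_unique by fastforce
  qed
  moreover have "bounded (u ` X)"
    unfolding bounded_iff using close[of _ 0] by (auto simp: w_def intro!: exI[of _ "M / (1 - \<gamma>)"])
  ultimately show ?thesis by blast
qed

lemma contraction_unique:
  fixes T :: "('x \<Rightarrow> real) \<Rightarrow> 'x \<Rightarrow> real"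
  assumes \<gamma>: "0 \<le> \<gamma>" "\<gamma> < 1"
    and contr: "\<And>u v c x. c \<ge> 0 \<Longrightarrow> (\<And>y. y \<in> X \<Longrightarrow> \<bar>u y - v y\<bar> \<le> c) \<Longrightarrow> x \<in> X \<Longrightarrow>
                  \<bar>T u x - T v x\<bar> \<le> \<gamma> * c"
    and u: "bounded (u ` X)" "\<And>x. x \<in> X \<Longrightarrow> u x = T u x"
    and v: "bounded (v ` X)" "\<And>x. x \<in> X \<Longrightarrow> v x = T v x"
    and x: "x \<in> X"
  shows "u x = v x"
proof -
  obtain b c where b: "\<And>y. y \<in> X \<Longrightarrow> \<bar>u y\<bar> \<le> b" and c: "\<And>y. y \<in> X \<Longrightarrow> \<bar>v y\<bar> \<le> c"
    using u(1) v(1) unfolding bounded_iff by auto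
  have "b + c \<ge> 0" using b[OF x] c[OF x] by linarith
  have "\<bar>u y - v y\<bar> \<le> (b + c) * \<gamma> ^ n" if "y \<in> X" for y n
    using that
  proof (induction n arbitrary: y)
    case 0 then show ?case using b[of y] c[of y] by simp
  next
    case (Suc n)
    have "\<bar>T u y - T v y\<bar> \<le> \<gamma> * ((b + c) * \<gamma> ^ n)"
      using Suc \<open>b + c \<ge> 0\<close> \<gamma> by (intro contr) auto
    then show ?case using u(2)[OF Suc.prems] v(2)[OF Suc.prems] by (simp add: mult_ac)
  qed
  then have "(\<lambda>n. u x - v x) \<longlonglongrightarrow> 0"
    using \<gamma> x
    by (intro Lim_null_comparison[OF _ tendsto_mult_right_zero[OF LIMSEQ_power_zero[of \<gamma>], of "b + c"]])
       auto
  then show ?thesis using LIMSEQ_unique[OF tendsto_const] by fastforce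
qed

lemma weighted_sum_diff:
  fixes w F G :: "'i \<Rightarrow> real"
  assumes "\<And>i. i \<in> I \<Longrightarrow> w i \<ge> 0" "sum w I \<le> 1" "c \<ge> 0"
    and "\<And>i. i \<in> I \<Longrightarrow> \<bar>F i - G i\<bar> \<le> c"
  shows "\<bar>(\<Sum>i\<in>I. w i * F i) - (\<Sum>i\<in>I. w i * G i)\<bar> \<le> c"
proof -
  have "\<bar>(\<Sum>i\<in>I. w i * F i) - (\<Sum>i\<in>I. w i * G i)\<bar> = \<bar>\<Sum>i\<in>I. w i * (F i - G i)\<bar>"
    by (simp add: sum_subtractf right_diff_distrib)
  also have "\<dots> \<le> (\<Sum>i\<in>I. \<bar>w i * (F i - G i)\<bar>)" by (rule sum_abs)
  also have "\<dots> \<le> (\<Sum>i\<in>I. w i * c)"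
    using assms by (intro sum_mono) (auto simp: abs_mult intro!: mult_left_mono)
  also have "\<dots> = sum w I * c" by (simp add: sum_distrib_right)
  also have "\<dots> \<le> c" using assms by (simp add: mult_left_le_one_le sum_nonneg)
  finally show ?thesis .
qed

text \<open>
  \<open>x\<close> is a state, \<open>i \<in> A\<close> an action, \<open>j \<in> J\<close> an outcome with weight \<open>k x i j\<close>, reward
  \<open>\<rho> j\<close> and successor \<open>n x i j\<close>.  This covers both the original and the surrogate process.
\<close>

definition bellman ::
  "real \<Rightarrow> 'i set \<Rightarrow> 'j set \<Rightarrow> ('x \<Rightarrow> 'i \<Rightarrow> real) \<Rightarrow> ('x \<Rightarrow> 'i \<Rightarrow> 'j \<Rightarrow> real) \<Rightarrow> ('j \<Rightarrow> real) \<Rightarrow>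
   ('x \<Rightarrow> 'i \<Rightarrow> 'j \<Rightarrow> 'x) \<Rightarrow> ('x \<Rightarrow> real) \<Rightarrow> 'x \<Rightarrow> real" where
  "bellman \<gamma> A J \<mu> k \<rho> n V x = (\<Sum>i\<in>A. \<mu> x i * (\<Sum>j\<in>J. k x i j * (\<rho> j + \<gamma> * V (n x i j))))"

context
  fixes \<gamma> :: real and A :: "'i set" and J :: "'j set" and X :: "'x set" and \<mu> k \<rho> n
  assumes \<gamma>: "0 \<le> \<gamma>" "\<gamma> < 1"
    and \<mu>: "\<And>x i. x \<in> X \<Longrightarrow> i \<in> A \<Longrightarrow> \<mu> x i \<ge> (0::real)" "\<And>x. x \<in> X \<Longrightarrow> sum (\<mu> x) A \<le> 1"
    and k: "\<And>x i j. x \<in> X \<Longrightarrow> i \<in> A \<Longrightarrow> j \<in> J \<Longrightarrow> k x i j \<ge> (0::real)"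
           "\<And>x i. x \<in> X \<Longrightarrow> i \<in> A \<Longrightarrow> sum (k x i) J \<le> 1"
    and \<rho>: "\<And>j. j \<in> J \<Longrightarrow> \<bar>\<rho> j\<bar> \<le> (1::real)"
    and n: "\<And>x i j. x \<in> X \<Longrightarrow> i \<in> A \<Longrightarrow> j \<in> J \<Longrightarrow> n x i j \<in> X"
begin

lemma bellman_contraction:
  assumes "c \<ge> 0" "\<And>y. y \<in> X \<Longrightarrow> \<bar>u y - v y\<bar> \<le> c" "x \<in> X"
  shows "\<bar>bellman \<gamma> A J \<mu> k \<rho> n u x - bellman \<gamma> A J \<mu> k \<rho> n v x\<bar> \<le> \<gamma> * c"
  unfolding bellman_def
proof (intro weighted_sum_diff)
  fix i j assume "i \<in> A" "j \<in> J"
  then have "\<bar>u (n x i j) - v (n x i j)\<bar> \<le> c" using n assms by auto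
  then have "\<gamma> * \<bar>u (n x i j) - v (n x i j)\<bar> \<le> \<gamma> * c" using \<gamma> by (intro mult_left_mono) auto
  moreover have "\<bar>\<rho> j + \<gamma> * u (n x i j) - (\<rho> j + \<gamma> * v (n x i j))\<bar> = \<gamma> * \<bar>u (n x i j) - v (n x i j)\<bar>"
    using \<gamma> by (simp add: abs_mult flip: right_diff_distrib)
  ultimately show "\<bar>\<rho> j + \<gamma> * u (n x i j) - (\<rho> j + \<gamma> * v (n x i j))\<bar> \<le> \<gamma> * c"
    by simp
qed (use \<gamma> \<mu> k assms in auto)

lemma bellman_bounded_at:
  assumes "C \<ge> 0" "\<And>y. y \<in> X \<Longrightarrow> \<bar>V y\<bar> \<le> C" "x \<in> X" "i \<in> A"
  shows "\<bar>\<Sum>j\<in>J. k x i j * (\<rho> j + \<gamma> * V (n x i j))\<bar> \<le> 1 + C"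
proof -
  have "\<bar>\<rho> j + \<gamma> * V (n x i j)\<bar> \<le> 1 + C" if "j \<in> J" for j
  proof -
    have "\<bar>\<gamma> * V (n x i j)\<bar> \<le> 1 * C"
      unfolding abs_mult using assms n that \<gamma> by (intro mult_mono) auto
    then show ?thesis using \<rho>[OF that] by linarith
  qed
  then show ?thesis
    using weighted_sum_diff[of J "k x i" "1 + C" "\<lambda>j. \<rho> j + \<gamma> * V (n x i j)" "\<lambda>_. 0"] k assms by simp
qed

lemma bellman_solution:
  "\<exists>V. bounded (V ` X) \<and> (\<forall>x\<in>X. V x = bellman \<gamma> A J \<mu> k \<rho> n V x)"
proof (rule contraction_fixpoint[OF \<gamma> bellman_contraction])
  fix x assume x: "x \<in> X"
  show "\<bar>bellman \<gamma> A J \<mu> k \<rho> n (\<lambda>_. 0) x\<bar> \<le> 1"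
    using weighted_sum_diff[of A "\<mu> x" 1 "\<lambda>i. \<Sum>j\<in>J. k x i j * (\<rho> j + \<gamma> * 0)" "\<lambda>_. 0"]
      \<mu> x bellman_bounded_at[of 0 "\<lambda>_. 0" x] by (simp add: bellman_def)
qed auto

lemma bellman_unique:
  assumes "bounded (u ` X)" "\<And>x. x \<in> X \<Longrightarrow> u x = bellman \<gamma> A J \<mu> k \<rho> n u x"
    and "bounded (v ` X)" "\<And>x. x \<in> X \<Longrightarrow> v x = bellman \<gamma> A J \<mu> k \<rho> n v x" "x \<in> X"
  shows "u x = v x"
  by (rule contraction_unique[OF \<gamma> bellman_contraction assms])

end

lemma sum_pmf_le_1:
  assumes "finite I"
  shows "(\<Sum>i\<in>I. pmf p i) \<le> 1"
  using assms by (simp flip: measure_measure_pmf_finite)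

lemma value_functions_bellman:
  assumes "value_functions R \<gamma> P pol Q V" "h \<in> histories R"
  shows "V h = bellman \<gamma> UNIV (UNIV \<times> R) (\<lambda>h. pmf (pol h)) (\<lambda>h a. pmf (P h a)) snd
           (\<lambda>h a (x, r). h @ [(a, x, r)]) V h"
proof -
  have Q: "\<And>a. Q h a = (\<Sum>(x, r)\<in>UNIV \<times> R. pmf (P h a) (x, r) * (r + \<gamma> * V (h @ [(a, x, r)])))"
    and V: "V h = (\<Sum>a\<in>UNIV. Q h a * pmf (pol h) a)"
    using assms by (auto simp: value_functions_def)
  show ?thesis unfolding V Q bellman_def by (simp add: case_prod_beta mult.commute)
qed

lemma value_functions_exist:
  fixes P :: "('a::finite, 'o::finite) history \<Rightarrow> 'a \<Rightarrow> ('o \<times> real) pmf"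
  assumes "0 \<le> \<gamma>" "\<gamma> < 1" "reward_set R"
  shows "\<exists>Q V. value_functions R \<gamma> P pol Q V"
proof -
  let ?k = "\<lambda>h a. pmf (P h a)" and ?n = "\<lambda>h a (x, r). h @ [(a, x, r)]"
  have R: "finite R" "\<And>r. r \<in> R \<Longrightarrow> \<bar>r\<bar> \<le> 1" using assms by (auto simp: reward_set_def)
  obtain V where V: "bounded (V ` histories R)" "\<And>h. h \<in> histories R \<Longrightarrow>
      V h = bellman \<gamma> UNIV (UNIV \<times> R) (\<lambda>h. pmf (pol h)) ?k snd ?n V h"
    using bellman_solution[of \<gamma> "histories R" UNIV "\<lambda>h. pmf (pol h)" "UNIV \<times> R" ?k snd ?n] assms R
    by (auto simp: sum_pmf_le_1 histories_def)
  define Q where "Q h a = (\<Sum>j\<in>UNIV \<times> R. ?k h a j * (snd j + \<gamma> * V (?n h a j)))" for h a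
  obtain C where C: "\<And>h. h \<in> histories R \<Longrightarrow> \<bar>V h\<bar> \<le> C"
    using V(1) unfolding bounded_iff by auto
  have C0: "C \<ge> 0" using C[of "[]"] by (auto simp: histories_def)
  have "\<bar>Q h a\<bar> \<le> 1 + C" if "h \<in> histories R" for h a
    unfolding Q_def
    by (rule bellman_bounded_at[of \<gamma> "histories R" UNIV "\<lambda>h. pmf (pol h)"])
       (use assms R C C0 that in \<open>auto simp: sum_pmf_le_1 histories_def\<close>)
  then have "bounded ((\<lambda>(h, a). Q h a) ` (histories R \<times> UNIV))"
    unfolding bounded_iff by (auto intro!: exI[of _ "1 + C"])
  moreover have "V h = (\<Sum>a\<in>UNIV. Q h a * pmf (pol h) a)" if "h \<in> histories R" for h
    using V(2)[OF that] by (simp add: bellman_def Q_def mult.commute)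
  ultimately have "value_functions R \<gamma> P pol Q V"
    using V(1) unfolding value_functions_def by (auto simp: Q_def case_prod_beta)
  then show ?thesis by blast
qed

lemma value_functions_unique:
  fixes P :: "('a::finite, 'o::finite) history \<Rightarrow> 'a \<Rightarrow> ('o \<times> real) pmf"
  assumes "0 \<le> \<gamma>" "\<gamma> < 1" "reward_set R"
    and 1: "value_functions R \<gamma> P pol Q V" and 2: "value_functions R \<gamma> P pol Q' V'"
    and h: "h \<in> histories R"
  shows "V h = V' h" "Q h a = Q' h a"
proof -
  have R: "finite R" "\<And>r. r \<in> R \<Longrightarrow> \<bar>r\<bar> \<le> 1" using assms by (auto simp: reward_set_def)
  have *: "V h = V' h" if "h \<in> histories R" for h
    by (rule bellman_unique[OF assms(1,2) _ _ _ _ _ _ _ value_functions_bellman[OF 1] _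
          value_functions_bellman[OF 2] that])
       (use R 1 2 in \<open>auto simp: sum_pmf_le_1 histories_def value_functions_def\<close>)
  show "V h = V' h" by (rule * [OF h])
  have "Q h a = (\<Sum>(x, r)\<in>UNIV \<times> R. pmf (P h a) (x, r) * (r + \<gamma> * V (h @ [(a, x, r)])))"
    using 1 h by (auto simp: value_functions_def)
  also have "\<dots> = (\<Sum>(x, r)\<in>UNIV \<times> R. pmf (P h a) (x, r) * (r + \<gamma> * V' (h @ [(a, x, r)])))"
  proof (intro sum.cong refl, clarify)
    fix x r assume "r \<in> R"
    then have "h @ [(a, x, r)] \<in> histories R" using h by (auto simp: histories_def)
    then show "pmf (P h a) (x, r) * (r + \<gamma> * V (h @ [(a, x, r)])) =
               pmf (P h a) (x, r) * (r + \<gamma> * V' (h @ [(a, x, r)]))" by (simp add: *)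
  qed
  also have "\<dots> = Q' h a"
    using 2 h by (auto simp: value_functions_def)
  finally show "Q h a = Q' h a" .
qed

lemma has_sum_finite_sum:
  fixes g :: "'j \<Rightarrow> 'x \<Rightarrow> real"
  assumes "finite J" "\<And>j. j \<in> J \<Longrightarrow> g j summable_on X"
  shows "((\<lambda>x. \<Sum>j\<in>J. g j x) has_sum (\<Sum>j\<in>J. infsum (g j) X)) X"
  using assms by (induction J rule: finite_induct) (auto intro!: has_sum_add)

lemma stoch_inv_nonneg: "0 \<le> stoch_inv B h a s b"
  by (simp add: stoch_inv_def cond_prob_def)

lemma stoch_inv_sum_le_1:
  assumes "finite F"
  shows "(\<Sum>(h, a)\<in>F. stoch_inv B h a s b) \<le> 1"
proof -
  let ?S = "{(h', a', s', b'). s' = s \<and> b' = b}"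
  let ?E = "\<lambda>(h, a). {(h', a', s', b'). (h' = h \<and> a' = a) \<and> s' = s \<and> b' = b}"
  have eq: "stoch_inv B h a s b = measure B (?E (h, a)) / measure B ?S" for h a
    unfolding stoch_inv_def cond_prob_def
    by (intro arg_cong2[where f = "(/)"] arg_cong[where f = "measure B"]) auto
  have "(\<Sum>x\<in>F. measure B (?E x)) = measure B (\<Union>x\<in>F. ?E x)"
    using assms by (intro measure_pmf.finite_measure_finite_Union[symmetric])
      (auto simp: disjoint_family_on_def)
  also have "\<dots> \<le> measure B ?S"
    by (intro measure_pmf.finite_measure_mono) auto
  finally have "(\<Sum>x\<in>F. measure B (?E x)) \<le> measure B ?S" .
  moreover have "(\<Sum>(h, a)\<in>F. stoch_inv B h a s b) = (\<Sum>x\<in>F. measure B (?E x)) / measure B ?S"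
    unfolding sum_divide_distrib by (intro sum.cong) (auto simp: eq)
  ultimately show ?thesis
    by (cases "measure B ?S = 0") (simp_all add: divide_le_eq_1 zero_less_measure_iff)
qed

lemma stoch_inv_summable: "(\<lambda>(h, a). stoch_inv B h a s b) summable_on X"
  by (rule nonneg_bounded_partial_sums_imp_summable_on[where C = 1])
     (auto simp: stoch_inv_nonneg intro!: eventually_finite_subsets_at_top_weakI stoch_inv_sum_le_1)

lemma stoch_inv_infsum_le_1: "(\<Sum>\<^sub>\<infinity>(h, a)\<in>X. stoch_inv B h a s b) \<le> 1"
  by (rule infsum_le_finite_sums[OF stoch_inv_summable stoch_inv_sum_le_1])

lemma abs_process_nonneg: "0 \<le> abs_process P f s' r h a"
  by (simp add: abs_process_def sum_nonneg)

lemma abs_process_sum_le_1: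
  fixes f :: "('a, 'o::finite) history \<Rightarrow> 's::finite"
  assumes "finite R"
  shows "(\<Sum>(s', r)\<in>UNIV \<times> R. abs_process P f s' r h a) \<le> 1"
proof -
  have "(\<Sum>(s', r)\<in>UNIV \<times> R. abs_process P f s' r h a) =
        (\<Sum>s'\<in>UNIV. \<Sum>r\<in>R. abs_process P f s' r h a)"
    by (rule sum.cartesian_product[symmetric])
  also have "\<dots> = (\<Sum>r\<in>R. \<Sum>s'\<in>UNIV. abs_process P f s' r h a)"
    by (rule sum.swap)
  also have "\<dots> = (\<Sum>r\<in>R. \<Sum>x\<in>UNIV. pmf (P h a) (x, r))"
    unfolding abs_process_def
    using sum.group[of UNIV UNIV "\<lambda>x. f (h @ [(a, x, r)])" "\<lambda>x. pmf (P h a) (x, r)" for r]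
    by (intro sum.cong refl) simp
  also have "\<dots> = (\<Sum>x\<in>UNIV. \<Sum>r\<in>R. pmf (P h a) (x, r))"
    by (rule sum.swap)
  also have "\<dots> = sum (pmf (P h a)) (UNIV \<times> R)"
    by (simp add: sum.cartesian_product)
  also have "\<dots> \<le> 1" using assms by (intro sum_pmf_le_1) auto
  finally show ?thesis .
qed

lemma surrogate_nonneg: "0 \<le> surrogate R P f B s' r s b"
  unfolding surrogate_def by (intro infsum_nonneg) (auto simp: abs_process_nonneg stoch_inv_nonneg)

lemma surrogate_sum_le_1:
  fixes f :: "('a, 'o::finite) history \<Rightarrow> 's::finite"
  assumes "finite R"
  shows "(\<Sum>(s', r)\<in>UNIV \<times> R. surrogate R P f B s' r s b) \<le> 1"
proof -
  let ?X = "histories R \<times> UNIV"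
  let ?g = "\<lambda>j x. abs_process P f (fst j) (snd j) (fst x) (snd x) * stoch_inv B (fst x) (snd x) s b"
  have "\<bar>abs_process P f s' r h a\<bar> \<le> 1" if "r \<in> R" for s' r h a
    using member_le_sum[of "(s', r)" "UNIV \<times> R" "\<lambda>(s', r). abs_process P f s' r h a"]
      abs_process_sum_le_1[OF assms, of P f h a] assms that
    by (auto simp: abs_process_nonneg)
  then have le: "?g j x \<le> stoch_inv B (fst x) (snd x) s b" if "j \<in> UNIV \<times> R" for j x
    using that by (auto intro!: mult_left_le_one_le simp: abs_process_nonneg stoch_inv_nonneg)
  have inv: "(\<lambda>x. stoch_inv B (fst x) (snd x) s b) summable_on ?X"
    using stoch_inv_summable[of B s b ?X] by (simp add: case_prod_unfold)
  have summ: "?g j summable_on ?X" if "j \<in> UNIV \<times> R" for j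
    by (rule summable_on_comparison_test[OF inv])
       (use le[OF that] in \<open>auto simp: abs_process_nonneg stoch_inv_nonneg\<close>)
  have "(\<Sum>(s', r)\<in>UNIV \<times> R. surrogate R P f B s' r s b) = (\<Sum>j\<in>UNIV \<times> R. infsum (?g j) ?X)"
    by (simp add: surrogate_def case_prod_unfold)
  also have "\<dots> = infsum (\<lambda>x. \<Sum>j\<in>UNIV \<times> R. ?g j x) ?X"
    using assms by (intro infsumI[symmetric] has_sum_finite_sum summ) auto
  also have "\<dots> \<le> infsum (\<lambda>x. stoch_inv B (fst x) (snd x) s b) ?X"
  proof (rule infsum_mono)
    show "(\<lambda>x. \<Sum>j\<in>UNIV \<times> R. ?g j x) summable_on ?X"
      using assms by (intro has_sum_imp_summable[OF has_sum_finite_sum] summ) auto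
    show "(\<lambda>x. stoch_inv B (fst x) (snd x) s b) summable_on ?X" by (rule inv)
    fix x
    have "(\<Sum>j\<in>UNIV \<times> R. abs_process P f (fst j) (snd j) (fst x) (snd x)) \<le> 1"
      using abs_process_sum_le_1[OF assms, of P f "fst x" "snd x"] by (simp add: case_prod_beta)
    then show "(\<Sum>j\<in>UNIV \<times> R. ?g j x) \<le> stoch_inv B (fst x) (snd x) s b"
      by (auto simp flip: sum_distrib_right intro!: mult_left_le_one_le
          simp: stoch_inv_nonneg abs_process_nonneg sum_nonneg)
  qed
  also have "\<dots> \<le> 1"
    using stoch_inv_infsum_le_1[of B s b ?X] by (simp add: case_prod_unfold)
  finally show ?thesis .
qed

lemma mdp_value_functions_bellman:
  assumes "mdp_value_functions R \<gamma> p \<pi> q v"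
  shows "v s = bellman \<gamma> UNIV (UNIV \<times> R) (\<lambda>s. pmf (\<pi> s)) (\<lambda>s b (s', r). p s' r s b) snd
           (\<lambda>s b j. fst j) v s"
proof -
  have q: "\<And>b. q s b = (\<Sum>(s', r)\<in>UNIV \<times> R. p s' r s b * (r + \<gamma> * v s'))"
    and v: "v s = (\<Sum>b\<in>UNIV. q s b * pmf (\<pi> s) b)"
    using assms unfolding mdp_value_functions_def by blast+
  show ?thesis unfolding v q bellman_def by (simp add: case_prod_beta mult.commute)
qed

lemma mdp_value_functions_exist:
  fixes f :: "('a, 'o::finite) history \<Rightarrow> 's::finite"
    and B :: "(('a, 'o) history \<times> 'a \<times> 's \<times> 'b::finite) pmf"
  assumes "0 \<le> \<gamma>" "\<gamma> < 1" "reward_set R"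
  shows "\<exists>q v. mdp_value_functions R \<gamma> (surrogate R P f B) \<pi> q v"
proof -
  let ?k = "\<lambda>s b (s', r). surrogate R P f B s' r s b"
  have R: "finite R" "\<And>r. r \<in> R \<Longrightarrow> \<bar>r\<bar> \<le> 1" using assms by (auto simp: reward_set_def)
  have "\<exists>v. bounded (range v) \<and>
      (\<forall>s\<in>UNIV. v s = bellman \<gamma> UNIV (UNIV \<times> R) (\<lambda>s. pmf (\<pi> s)) ?k snd (\<lambda>s b j. fst j) v s)"
    by (rule bellman_solution)
       (use assms R in \<open>auto simp: sum_pmf_le_1 surrogate_nonneg surrogate_sum_le_1\<close>)
  then obtain v where
    v: "\<And>s. v s = bellman \<gamma> UNIV (UNIV \<times> R) (\<lambda>s. pmf (\<pi> s)) ?k snd (\<lambda>s b j. fst j) v s"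
    by blast
  define q where "q s b = (\<Sum>(s', r)\<in>UNIV \<times> R. surrogate R P f B s' r s b * (r + \<gamma> * v s'))" for s b
  have "v s = (\<Sum>b\<in>UNIV. q s b * pmf (\<pi> s) b)" for s
    using v[of s] by (simp add: bellman_def q_def case_prod_beta mult.commute)
  then have "mdp_value_functions R \<gamma> (surrogate R P f B) \<pi> q v"
    unfolding mdp_value_functions_def using q_def by blast
  then show ?thesis by blast
qed

lemma mdp_value_functions_unique:
  fixes f :: "('a, 'o::finite) history \<Rightarrow> 's::finite"
    and B :: "(('a, 'o) history \<times> 'a \<times> 's \<times> 'b::finite) pmf"
  assumes "0 \<le> \<gamma>" "\<gamma> < 1" "reward_set R"
    and 1: "mdp_value_functions R \<gamma> (surrogate R P f B) \<pi> q v"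
    and 2: "mdp_value_functions R \<gamma> (surrogate R P f B) \<pi> q' v'"
  shows "v = v'" "q = q'"
proof -
  have R: "finite R" "\<And>r. r \<in> R \<Longrightarrow> \<bar>r\<bar> \<le> 1" using assms by (auto simp: reward_set_def)
  show *: "v = v'"
  proof
    fix s
    show "v s = v' s"
      by (rule bellman_unique[OF assms(1,2) _ _ _ _ _ _ _ mdp_value_functions_bellman[OF 1] _
            mdp_value_functions_bellman[OF 2], of UNIV])
         (use R in \<open>auto simp: sum_pmf_le_1 surrogate_nonneg surrogate_sum_le_1 finite_imp_bounded\<close>)
  qed
  show "q = q'"
  proof (intro ext)
    fix s b
    have "q s b = (\<Sum>(s', r)\<in>UNIV \<times> R. surrogate R P f B s' r s b * (r + \<gamma> * v' s'))"
      using 1 unfolding mdp_value_functions_def * by blast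
    also have "\<dots> = q' s b"
      using 2 unfolding mdp_value_functions_def by metis
    finally show "q s b = q' s b" .
  qed
qed

end

theory Submission
  imports Defs
begin

text \<open>
  Let \<open>W\<close> be the supremum of \<open>\<bar>V h - v (f h)\<bar>\<close>.  Both \<open>\<langle>Q\<rangle>\<^sub>B\<close> and \<open>q\<close> are averages over the same
  weights \<open>B(h a | s b)\<close>, and the rewards cancel, so they differ by at most \<open>\<gamma> W\<close>.  Averaging
  \<open>\<langle>Q\<rangle>\<^sub>B\<close> over the abstract policy gives \<open>\<Sum>\<^sub>h B(h | s) \<Sum>\<^sub>a Q h a B\<^sup>\<pi>(a | h s)\<close>, which is within
  \<open>\<epsilon> + \<epsilon>\<^sub>B\<close> of \<open>V h\<close>.  Hence \<open>W \<le> \<epsilon> + \<epsilon>\<^sub>B + \<gamma> W\<close>.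
\<close>

section \<open>Weighted infinite sums and bounds on value functions\<close>

lemma weighted_summable_on:
  fixes w F :: "'x \<Rightarrow> real"
  assumes "w summable_on X" "\<And>x. x \<in> X \<Longrightarrow> 0 \<le> w x" "\<And>x. x \<in> X \<Longrightarrow> \<bar>F x\<bar> \<le> K"
  shows "(\<lambda>x. w x * F x) summable_on X"
proof -
  have "(\<lambda>x. norm (w x * F x)) summable_on X"
  proof (rule Infinite_Sum.abs_summable_on_comparison_test')
    show "(\<lambda>x. w x * K) summable_on X" by (rule summable_on_cmult_left[OF assms(1)])
  qed (use assms in \<open>auto simp: abs_mult intro!: mult_left_mono\<close>)
  then show ?thesis by (rule iffD2[OF summable_on_iff_abs_summable_on_real])
qed

text \<open>Infinite counterpart of \<open>weighted_sum_diff\<close>. A divergent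
  \<open>infsum\<close> is 0 by convention, so convergence of both sums has to be secured: the bound
  \<open>K\<close> does it for \<open>F\<close>, and closeness passes the bound \<open>K + c\<close>
  on to \<open>G\<close>.\<close>

lemma weighted_infsum_diff:
  fixes w F G :: "'x \<Rightarrow> real"
  assumes "w summable_on X" "\<And>x. x \<in> X \<Longrightarrow> 0 \<le> w x" "infsum w X \<le> 1" "0 \<le> c"
    and "\<And>x. x \<in> X \<Longrightarrow> \<bar>F x\<bar> \<le> K" "\<And>x. x \<in> X \<Longrightarrow> \<bar>F x - G x\<bar> \<le> c"
  shows "\<bar>(\<Sum>\<^sub>\<infinity>x\<in>X. w x * F x) - (\<Sum>\<^sub>\<infinity>x\<in>X. w x * G x)\<bar> \<le> c"
proof -
  have G: "\<bar>G x\<bar> \<le> K + c" if "x \<in> X" for x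
    using assms(5)[OF that] assms(6)[OF that] by linarith
  have "((\<lambda>x. w x * F x + - (w x * G x)) has_sum
          (\<Sum>\<^sub>\<infinity>x\<in>X. w x * F x) + - (\<Sum>\<^sub>\<infinity>x\<in>X. w x * G x)) X"
    by (intro has_sum_add has_sum_uminusI has_sum_infsum weighted_summable_on[where F = F and K = K]
          weighted_summable_on[where F = G and K = "K + c"] assms G)
  \<comment> \<open>This majorant dominates the difference termwise and sums to at most
    \<open>c\<close>, as the total weight is at most 1.\<close>
  moreover have "((\<lambda>x. w x * c) has_sum infsum w X * c) X"
    by (intro has_sum_cmult_left has_sum_infsum assms)
  ultimately have "norm ((\<Sum>\<^sub>\<infinity>x\<in>X. w x * F x) + - (\<Sum>\<^sub>\<infinity>x\<in>X. w x * G x)) \<le> infsum w X * c"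
    by (rule norm_infsum_le)
       (use assms in \<open>auto simp: abs_mult simp flip: right_diff_distrib intro!: mult_left_mono\<close>)
  also have "\<dots> \<le> c"
    using assms by (intro mult_left_le_one_le infsum_nonneg) auto
  finally show ?thesis by simp
qed

lemma value_functions_boundedE:
  assumes "value_functions R \<gamma> P pol Q V"
  obtains K L where "\<forall>h\<in>histories R. \<forall>a. \<bar>Q h a\<bar> \<le> K" "\<forall>h\<in>histories R. \<bar>V h\<bar> \<le> L"
proof -
  have "bounded ((\<lambda>(h, a). Q h a) ` (histories R \<times> UNIV))" "bounded (V ` histories R)"
    using assms unfolding value_functions_def by blast+
  then obtain K L where "\<forall>y\<in>(\<lambda>(h, a). Q h a) ` (histories R \<times> UNIV). norm y \<le> K"
      and "\<forall>y\<in>V ` histories R. norm y \<le> L"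
    unfolding bounded_iff by blast
  then show thesis by (intro that[of K L]) auto
qed

section \<open>Marginals and conditionals of \<open>B\<close>\<close>

lemma pmf_has_sum: "(pmf p has_sum measure p A) A"
proof -
  have "pmf p summable_on A"
    by (rule iffD2[OF summable_on_iff_abs_summable_on_real])
       (rule iffD2[OF abs_summable_equivalent pmf_abs_summable])
  moreover have "infsum (pmf p) A = measure p A"
    by (simp add: measure_pmf_conv_infsetsum infsetsum_infsum pmf_abs_summable)
  ultimately show ?thesis using has_sum_infsum[of "pmf p" A] by simp
qed

text \<open>Fixing history and action on top of state and abstract action leaves one tuple, so the
  numerator of the conditional probability is a single point mass.\<close>

lemma stoch_inv_eq_pmf:
  "stoch_inv B h a s b = pmf B (h, a, s, b) / \<P>((h', a', s', b') in B. s' = s \<and> b' = b)"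
proof -
  have "{x \<in> space B. (case x of (h', a', s', b') \<Rightarrow> h' = h \<and> a' = a) \<and>
          (case x of (h', a', s', b') \<Rightarrow> s' = s \<and> b' = b)} = {(h, a, s, b)}"
    by auto
  then show ?thesis by (simp add: stoch_inv_def cond_prob_def pmf.rep_eq)
qed

lemma joint_distribution_pmf_eq_0:
  assumes "joint_distribution R \<psi> B" "\<psi> (h, a) \<noteq> (s, b)"
  shows "pmf B (h, a, s, b) = 0"
  using assms by (force simp: joint_distribution_def pmf_eq_0_set_pmf)

lemma joint_distribution_state_pos:
  assumes "joint_distribution R \<psi> B"
  shows "0 < \<P>((h', a', s', b') in B. s' = s)"
proof -
  \<comment> \<open>\<open>undefined\<close> serves as some element of the nonempty type of abstract
    actions.\<close>
  have "0 < \<P>((h', a', s', b') in B. s' = s \<and> b' = undefined)"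
    using assms by (auto simp: joint_distribution_def)
  also have "\<dots> \<le> \<P>((h', a', s', b') in B. s' = s)"
    by (intro measure_pmf.finite_measure_mono) auto
  finally show ?thesis .
qed

text \<open>This is where \<open>lifted_policy\<close> comes from: averaging B(ha|sb) = B(h|s)
  B(ab|h) / B(b|s) over \<open>\<pi>\<close> pulls out the factor B(h|s). It appears as B(h) / B(s),
  since on the support of \<open>B\<close> a history with \<open>f h = s\<close> occurs only with
  state \<open>s\<close>.\<close>

lemma stoch_inv_policy_sum:
  fixes B :: "(('a, 'o) history \<times> 'a::finite \<times> 's \<times> 'b::finite) pmf"
  assumes hom: "homomorphism R \<psi> f" and B: "joint_distribution R \<psi> B"
    and h: "h \<in> histories R" "f h = s"
  shows "(\<Sum>b\<in>UNIV. pmf (\<pi> s) b * stoch_inv B h a s b) =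
         \<P>((h', a', s', b') in B. h' = h) / \<P>((h', a', s', b') in B. s' = s) *
         lifted_policy B \<pi> a h s"
proof -
  let ?H = "\<P>((h', a', s', b') in B. h' = h)" and ?S = "\<P>((h', a', s', b') in B. s' = s)"
  let ?SB = "\<lambda>b. \<P>((h', a', s', b') in B. s' = s \<and> b' = b)"
  have pos: "0 < ?H" "0 < ?SB b" for b
    using B h by (auto simp: joint_distribution_def)
  have "0 < ?S" by (rule joint_distribution_state_pos[OF B])
  have fst: "fst (\<psi> (h, a)) = s"
    using hom h by (auto simp: homomorphism_def)
  \<comment> \<open>The event on the left leaves the abstract state free, but tuples whose state
    differs from \<open>f h\<close> lie off the support of \<open>B\<close>.\<close>
  have num: "\<P>(x in B. (case x of (h', a', s', b') \<Rightarrow> a' = a \<and> b' = b) \<and>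
               (case x of (h', a', s', b') \<Rightarrow> h' = h)) = pmf B (h, a, s, b)" for b
    unfolding pmf.rep_eq
  proof (rule measure_prob_cong_0, goal_cases)
    case (1 x)
    then obtain s' where "x = (h, a, s', b)" "s' \<noteq> s" by auto
    then show "pmf B x = 0" using fst by (auto intro!: joint_distribution_pmf_eq_0[OF B])
  qed auto
  have den: "\<P>(x in B. (case x of (h', a', s', b') \<Rightarrow> b' = b) \<and>
               (case x of (h', a', s', b') \<Rightarrow> s' = s)) = ?SB b" for b
    by (intro arg_cong[where f = "measure B"]) auto
  have H: "\<P>(x in B. case x of (h', a', s', b') \<Rightarrow> h' = h) = ?H"
    and S: "\<P>(x in B. case x of (h', a', s', b') \<Rightarrow> s' = s) = ?S"
    by (intro arg_cong[where f = "measure B"]; auto)+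
  show ?thesis
    unfolding lifted_policy_def cond_prob_def num den H S stoch_inv_eq_pmf sum_distrib_left
  proof (intro sum.cong refl)
    fix b
    show "pmf (\<pi> s) b * (pmf B (h, a, s, b) / ?SB b) =
          ?H / ?S * (pmf B (h, a, s, b) / ?H / (?SB b / ?S) * pmf (\<pi> s) b)"
      \<comment> \<open>The marginals of \<open>h\<close> and \<open>s\<close> are positive and
        cancel on the right, leaving the left side.\<close>
      using pos(1) pos(2)[of b] \<open>0 < ?S\<close> by (simp add: field_simps)
  qed
qed

text \<open>On the support of \<open>B\<close> the history determines the state through
  \<open>f\<close>, so the history marginal gives the fibre of \<open>s\<close> exactly the mass of
  state \<open>s\<close>; dividing by that mass normalizes it.\<close>

lemma history_given_state_has_sum:
  assumes hom: "homomorphism R \<psi> f" and B: "joint_distribution R \<psi> B"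
  shows "((\<lambda>h. \<P>((h', a', s', b') in B. h' = h) / \<P>((h', a', s', b') in B. s' = s)) has_sum 1)
           {h \<in> histories R. f h = s}"
proof -
  let ?S = "\<P>((h', a', s', b') in B. s' = s)" and ?X = "{h \<in> histories R. f h = s}"
  have "0 < ?S" by (rule joint_distribution_state_pos[OF B])
  have "measure (map_pmf fst B) ?X = ?S"
    unfolding measure_map_pmf
  proof (rule measure_prob_cong_0)
    have *: "h \<in> histories R \<and> f h = s'" if "(h, a, s', b) \<in> set_pmf B" for h a s' b
    proof -
      have "h \<in> histories R" "\<psi> (h, a) = (s', b)"
        using B that unfolding joint_distribution_def by blast+
      moreover from this have "fst (\<psi> (h, a)) = f h"
        using hom unfolding homomorphism_def by blast
      ultimately show ?thesis by simp
    qed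
    show "pmf B x = 0" if "x \<in> fst -` ?X - {(h', a', s', b'). (h', a', s', b') \<in> space B \<and> s' = s}" for x
      using that * by (cases x) (auto simp: pmf_eq_0_set_pmf)
    show "pmf B x = 0" if "x \<in> {(h', a', s', b'). (h', a', s', b') \<in> space B \<and> s' = s} - fst -` ?X" for x
      using that * by (cases x) (auto simp: pmf_eq_0_set_pmf)
  qed
  then have "(pmf (map_pmf fst B) has_sum ?S) ?X"
    using pmf_has_sum[of "map_pmf fst B" ?X] by simp
  then have "((\<lambda>h. pmf (map_pmf fst B) h / ?S) has_sum ?S / ?S) ?X"
    unfolding divide_inverse by (rule has_sum_cmult_left)
  moreover have "pmf (map_pmf fst B) h = \<P>((h', a', s', b') in B. h' = h)" for h
    unfolding pmf_map by (intro arg_cong[where f = "measure B"]) auto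
  ultimately show ?thesis using \<open>0 < ?S\<close> by simp
qed

text \<open>Regroups the average by history, so that the inner sum over actions becomes the one that
  the \<open>\<epsilon>\<^sub>B\<close> hypothesis of the theorem controls. Boundedness of
  \<open>Q\<close> justifies the exchange of sums.\<close>

lemma B_average_policy_sum:
  fixes B :: "(('a::finite, 'o) history \<times> 'a \<times> 's \<times> 'b::finite) pmf"
  assumes hom: "homomorphism R \<psi> f" and B: "joint_distribution R \<psi> B"
    and Q: "\<And>h a. h \<in> histories R \<Longrightarrow> \<bar>Q h a\<bar> \<le> K"
  shows "(\<Sum>b\<in>UNIV. pmf (\<pi> s) b * B_average R B Q s b) =
         (\<Sum>\<^sub>\<infinity>h | h \<in> histories R \<and> f h = s.
            \<P>((h', a', s', b') in B. h' = h) / \<P>((h', a', s', b') in B. s' = s) *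
            (\<Sum>a\<in>UNIV. Q h a * lifted_policy B \<pi> a h s))"
proof -
  let ?X = "{h \<in> histories R. f h = s}"
  let ?w = "\<lambda>h. \<P>((h', a', s', b') in B. h' = h) / \<P>((h', a', s', b') in B. s' = s)"
  let ?g = "\<lambda>b x. stoch_inv B (fst x) (snd x) s b * Q (fst x) (snd x)"
  \<comment> \<open>Off the fibre of \<open>s\<close> the stochastic inverse vanishes. Restricting
    the range first lets \<open>stoch_inv_policy_sum\<close>, which assumes \<open>f h = s\<close>,
    apply to every remaining history.\<close>
  have avg: "B_average R B Q s b = infsum (?g b) (?X \<times> UNIV)" for b
    unfolding B_average_def
  proof (rule infsum_cong_neutral)
    fix x assume "x \<in> histories R \<times> UNIV - ?X \<times> (UNIV :: 'a set)"
    then obtain h a where x: "x = (h, a)" "h \<in> histories R" "f h \<noteq> s" by auto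
    then have "fst (\<psi> (h, a)) \<noteq> s" using hom by (auto simp: homomorphism_def)
    then have "\<psi> (h, a) \<noteq> (s, b)" by auto
    then show "(case x of (h, a) \<Rightarrow> Q h a * stoch_inv B h a s b) = 0"
      using joint_distribution_pmf_eq_0[OF B] x by (simp add: stoch_inv_eq_pmf)
  qed (auto simp: mult.commute)
  have "?g b summable_on ?X \<times> UNIV" for b
    using stoch_inv_summable[of B s b "?X \<times> UNIV"] Q
    by (intro weighted_summable_on[where K = K]) (auto simp: case_prod_unfold stoch_inv_nonneg)
  then have "((\<lambda>x. \<Sum>b\<in>UNIV. pmf (\<pi> s) b * ?g b x) has_sum
      (\<Sum>b\<in>UNIV. infsum (\<lambda>x. pmf (\<pi> s) b * ?g b x) (?X \<times> UNIV))) (?X \<times> UNIV)"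
    by (intro has_sum_finite_sum summable_on_cmult_right) auto
  then have "((\<lambda>x. \<Sum>b\<in>UNIV. pmf (\<pi> s) b * ?g b x) has_sum
      (\<Sum>b\<in>UNIV. pmf (\<pi> s) b * B_average R B Q s b)) (?X \<times> UNIV)"
    unfolding avg infsum_cmult_right' .
  \<comment> \<open>The convergent sum over pairs is iterated, with a finite inner sum over
    actions.\<close>
  then have "((\<lambda>h. \<Sum>a\<in>UNIV. \<Sum>b\<in>UNIV. pmf (\<pi> s) b * ?g b (h, a)) has_sum
      (\<Sum>b\<in>UNIV. pmf (\<pi> s) b * B_average R B Q s b)) ?X"
    by (rule has_sum_Sigma') (auto intro: has_sum_finite)
  then have "(\<Sum>b\<in>UNIV. pmf (\<pi> s) b * B_average R B Q s b) =
      (\<Sum>\<^sub>\<infinity>h\<in>?X. \<Sum>a\<in>UNIV. \<Sum>b\<in>UNIV. pmf (\<pi> s) b * ?g b (h, a))"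
    by (rule infsumI[symmetric])
  also have "\<dots> = (\<Sum>\<^sub>\<infinity>h\<in>?X. ?w h * (\<Sum>a\<in>UNIV. Q h a * lifted_policy B \<pi> a h s))"
  proof (rule infsum_cong)
    fix h assume h: "h \<in> ?X"
    have "(\<Sum>b\<in>UNIV. pmf (\<pi> s) b * ?g b (h, a)) = ?w h * (Q h a * lifted_policy B \<pi> a h s)" for a
    proof -
      have "(\<Sum>b\<in>UNIV. pmf (\<pi> s) b * ?g b (h, a)) =
          (\<Sum>b\<in>UNIV. pmf (\<pi> s) b * stoch_inv B h a s b) * Q h a"
        by (simp add: sum_distrib_left mult_ac)
      also have "\<dots> = ?w h * lifted_policy B \<pi> a h s * Q h a"
        using stoch_inv_policy_sum[OF hom B] h by auto
      finally show ?thesis by (simp only: mult_ac)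
    qed
    then show "(\<Sum>a\<in>UNIV. \<Sum>b\<in>UNIV. pmf (\<pi> s) b * ?g b (h, a)) =
        ?w h * (\<Sum>a\<in>UNIV. Q h a * lifted_policy B \<pi> a h s)"
      by (simp only: sum_distrib_left)
  qed
  finally show ?thesis .
qed

section \<open>Expectations under the abstract and surrogate processes\<close>

lemma abs_process_sum:
  fixes f :: "('a, 'o::finite) history \<Rightarrow> 's::finite"
  shows "(\<Sum>(s', r)\<in>UNIV \<times> R. abs_process P f s' r h a * g s' r) =
         (\<Sum>(x, r)\<in>UNIV \<times> R. pmf (P h a) (x, r) * g (f (h @ [(a, x, r)])) r)"
proof -
  have "(\<Sum>s'\<in>UNIV. abs_process P f s' r h a * g s' r) =
        (\<Sum>x\<in>UNIV. pmf (P h a) (x, r) * g (f (h @ [(a, x, r)])) r)" for r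
  proof -
    \<comment> \<open>Inside the fibre of \<open>s'\<close> the argument \<open>s'\<close> may be
      replaced by the abstract successor itself; the summand then no longer mentions
      \<open>s'\<close>, and the fibres glue together.\<close>
    have "(\<Sum>s'\<in>UNIV. abs_process P f s' r h a * g s' r) =
      (\<Sum>s'\<in>UNIV. \<Sum>x | x \<in> UNIV \<and> f (h @ [(a, x, r)]) = s'.
         pmf (P h a) (x, r) * g (f (h @ [(a, x, r)])) r)"
      unfolding abs_process_def sum_distrib_right by (intro sum.cong) auto
    also have "\<dots> = (\<Sum>x\<in>UNIV. pmf (P h a) (x, r) * g (f (h @ [(a, x, r)])) r)"
      by (rule sum.group) auto
    finally show ?thesis .
  qed
  then have "(\<Sum>r\<in>R. \<Sum>s'\<in>UNIV. abs_process P f s' r h a * g s' r) =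
      (\<Sum>r\<in>R. \<Sum>x\<in>UNIV. pmf (P h a) (x, r) * g (f (h @ [(a, x, r)])) r)"
    by simp
  \<comment> \<open>Both products sum over rewards innermost; the swaps bring the reward outside,
    where the identity for fixed \<open>r\<close> applies.\<close>
  then show ?thesis
    unfolding sum.cartesian_product[symmetric] by (subst (1 2) sum.swap)
qed

text \<open>Turns a one-step expectation in the surrogate into a \<open>B\<close>-average of
  one-step expectations in the original process, which puts \<open>q\<close> and
  \<open>B_average\<close> on the same weights.\<close>

lemma surrogate_sum:
  fixes f :: "('a::finite, 'o::finite) history \<Rightarrow> 's::finite"
  assumes "finite R"
  shows "(\<Sum>(s', r)\<in>UNIV \<times> R. surrogate R P f B s' r s b * g s' r) =
         (\<Sum>\<^sub>\<infinity>(h, a)\<in>histories R \<times> UNIV. stoch_inv B h a s b *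
            (\<Sum>(x, r)\<in>UNIV \<times> R. pmf (P h a) (x, r) * g (f (h @ [(a, x, r)])) r))"
proof -
  let ?X = "histories R \<times> UNIV"
  let ?k = "\<lambda>j x. stoch_inv B (fst x) (snd x) s b * abs_process P f (fst j) (snd j) (fst x) (snd x)"
  \<comment> \<open>A single nonnegative entry is at most the total over all pairs, hence at most 1;
    this bound gives the summability that follows.\<close>
  have "\<bar>abs_process P f s' r h a\<bar> \<le> 1" if "r \<in> R" for s' r h a
    using member_le_sum[of "(s', r)" "UNIV \<times> R" "\<lambda>(s', r). abs_process P f s' r h a"]
      abs_process_sum_le_1[OF assms, of P f h a] assms that
    by (auto simp: abs_process_nonneg)
  then have summ: "?k j summable_on ?X" if "j \<in> UNIV \<times> R" for j
    using that stoch_inv_summable[of B s b ?X]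
    by (intro weighted_summable_on[where K = 1]) (auto simp: case_prod_unfold stoch_inv_nonneg)
  have "(\<Sum>(s', r)\<in>UNIV \<times> R. surrogate R P f B s' r s b * g s' r) =
      (\<Sum>j\<in>UNIV \<times> R. infsum (\<lambda>x. ?k j x * g (fst j) (snd j)) ?X)"
    by (simp add: surrogate_def case_prod_unfold infsum_cmult_left' mult.commute[of "stoch_inv _ _ _ _ _"])
  also have "\<dots> = (\<Sum>\<^sub>\<infinity>x\<in>?X. \<Sum>j\<in>UNIV \<times> R. ?k j x * g (fst j) (snd j))"
    using assms by (intro infsumI[symmetric] has_sum_finite_sum summable_on_cmult_left summ) auto
  also have "\<dots> = (\<Sum>\<^sub>\<infinity>(h, a)\<in>?X. stoch_inv B h a s b *
      (\<Sum>(s', r)\<in>UNIV \<times> R. abs_process P f s' r h a * g s' r))"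
    by (simp add: case_prod_unfold sum_distrib_left mult.assoc)
  finally show ?thesis unfolding abs_process_sum .
qed

text \<open>\<open>V\<close> and \<open>v\<close> enter only at successors, hence behind one factor
  \<open>\<gamma>\<close>. Any uniform bound \<open>W\<close> is allowed, so that the supremum can
  be inserted later.\<close>

lemma B_average_surrogate_diff:
  fixes P :: "('a::finite, 'o::finite) history \<Rightarrow> 'a \<Rightarrow> ('o \<times> real) pmf"
    and f :: "('a, 'o) history \<Rightarrow> 's::finite"
    and B :: "(('a, 'o) history \<times> 'a \<times> 's \<times> 'b::finite) pmf"
  assumes "finite R" "0 \<le> \<gamma>" and val: "value_functions R \<gamma> P pol Q V"
    and q: "mdp_value_functions R \<gamma> (surrogate R P f B) \<pi> q v"
    and W: "0 \<le> W" "\<And>h. h \<in> histories R \<Longrightarrow> \<bar>V h - v (f h)\<bar> \<le> W"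
  shows "\<bar>B_average R B Q s b - q s b\<bar> \<le> \<gamma> * W"
proof -
  let ?X = "histories R \<times> (UNIV :: 'a set)"
  let ?G = "\<lambda>(h, a). \<Sum>(x, r)\<in>UNIV \<times> R. pmf (P h a) (x, r) * (r + \<gamma> * v (f (h @ [(a, x, r)])))"
  obtain K where K: "\<forall>h\<in>histories R. \<forall>a. \<bar>Q h a\<bar> \<le> K"
    by (rule value_functions_boundedE[OF val]) (rule that)
  have "q s b = (\<Sum>(s', r)\<in>UNIV \<times> R. surrogate R P f B s' r s b * (r + \<gamma> * v s'))"
    using q unfolding mdp_value_functions_def by blast
  also have "\<dots> = (\<Sum>\<^sub>\<infinity>x\<in>?X. stoch_inv B (fst x) (snd x) s b * ?G x)"
    unfolding surrogate_sum[OF assms(1), where g = "\<lambda>s' r. r + \<gamma> * v s'"]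
    by (simp add: case_prod_unfold)
  finally have q_eq: "q s b = (\<Sum>\<^sub>\<infinity>x\<in>?X. stoch_inv B (fst x) (snd x) s b * ?G x)" .
  have "\<bar>Q h a - ?G (h, a)\<bar> \<le> \<gamma> * W" if h: "h \<in> histories R" for h a
  proof -
    have "Q h a = (\<Sum>j\<in>UNIV \<times> R. pmf (P h a) j * (snd j + \<gamma> * V (h @ [(a, j)])))"
      using val h by (simp add: value_functions_def case_prod_unfold)
    moreover have "?G (h, a) =
        (\<Sum>j\<in>UNIV \<times> R. pmf (P h a) j * (snd j + \<gamma> * v (f (h @ [(a, j)]))))"
      by (simp add: case_prod_unfold)
    moreover have "\<bar>(snd j + \<gamma> * V (h @ [(a, j)])) - (snd j + \<gamma> * v (f (h @ [(a, j)])))\<bar> \<le> \<gamma> * W"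
      if "j \<in> UNIV \<times> R" for j
    proof -
      \<comment> \<open>Appending an outcome with reward in \<open>R\<close> stays in
        \<open>histories R\<close>, so \<open>W\<close> applies at the successor.\<close>
      have "h @ [(a, j)] \<in> histories R" using h that by (auto simp: histories_def)
      then have "\<gamma> * \<bar>V (h @ [(a, j)]) - v (f (h @ [(a, j)]))\<bar> \<le> \<gamma> * W"
        using W assms(2) by (intro mult_left_mono) auto
      then show ?thesis using assms(2) by (simp add: abs_mult flip: right_diff_distrib)
    qed
    ultimately show ?thesis
      using weighted_sum_diff[of "UNIV \<times> R" "pmf (P h a)" "\<gamma> * W"] assms(1,2) W
      by (simp add: sum_pmf_le_1)
  qed
  then have "\<bar>(\<Sum>\<^sub>\<infinity>x\<in>?X. stoch_inv B (fst x) (snd x) s b * Q (fst x) (snd x)) -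
      (\<Sum>\<^sub>\<infinity>x\<in>?X. stoch_inv B (fst x) (snd x) s b * ?G x)\<bar> \<le> \<gamma> * W"
    using stoch_inv_summable[of B s b ?X] stoch_inv_infsum_le_1[of B s b ?X] K assms(2) W
    by (intro weighted_infsum_diff[where K = K]) (auto simp: case_prod_unfold stoch_inv_nonneg)
  moreover have "B_average R B Q s b =
      (\<Sum>\<^sub>\<infinity>x\<in>?X. stoch_inv B (fst x) (snd x) s b * Q (fst x) (snd x))"
    by (simp add: B_average_def case_prod_unfold mult.commute)
  ultimately show ?thesis by (simp add: q_eq)
qed

section \<open>The self-bounding inequality for the largest value gap\<close>

theorem theorem9:
  fixes R :: "real set" and \<gamma> \<epsilon> \<epsilon>\<^sub>B :: real
    and P :: "('a::finite, 'o::finite) history \<Rightarrow> 'a \<Rightarrow> ('o \<times> real) pmf"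
    and pol :: "('a, 'o) history \<Rightarrow> 'a pmf"
    and Q :: "('a, 'o) history \<Rightarrow> 'a \<Rightarrow> real" and V :: "('a, 'o) history \<Rightarrow> real"
    and \<psi> :: "('a, 'o) history \<times> 'a \<Rightarrow> 's::finite \<times> 'b::finite"
    and f :: "('a, 'o) history \<Rightarrow> 's"
    and B :: "(('a, 'o) history \<times> 'a \<times> 's \<times> 'b) pmf"
    and \<pi>\<^sub>R :: "'s \<Rightarrow> 'b pmf"
    and q :: "'s \<Rightarrow> 'b \<Rightarrow> real" and v :: "'s \<Rightarrow> real"
  assumes "reward_set R" and "0 \<le> \<gamma>" and "\<gamma> < 1"
    and "process R P"
    and "value_functions R \<gamma> P pol Q V"
    and "homomorphism R \<psi> f"
    and "joint_distribution R \<psi> B"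
    and "representative_policy R \<psi> f pol \<pi>\<^sub>R"
    and "mdp_value_functions R \<gamma> (surrogate R P f B) \<pi>\<^sub>R q v"
    and "0 \<le> \<epsilon>" and "0 \<le> \<epsilon>\<^sub>B"
    and "\<forall>h\<in>histories R. \<forall>h'\<in>histories R. f h = f h' \<longrightarrow> \<bar>V h - V h'\<bar> \<le> \<epsilon>"
    and "\<forall>h\<in>histories R.
           \<bar>(\<Sum>a\<in>UNIV. Q h a * lifted_policy B \<pi>\<^sub>R a h (f h)) - V h\<bar> \<le> \<epsilon>\<^sub>B"
  shows "\<forall>s b. \<forall>h\<in>histories R. f h = s \<longrightarrow>
           \<bar>B_average R B Q s b - q s b\<bar> \<le> \<gamma> * (\<epsilon> + \<epsilon>\<^sub>B) / (1 - \<gamma>) \<and>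
           \<bar>V h - v s\<bar> \<le> (\<epsilon> + \<epsilon>\<^sub>B) / (1 - \<gamma>)"
proof -
  note gamma = assms(2,3) and val = assms(5) and hom = assms(6) and B = assms(7)
    and q = assms(9) and eps = assms(10,11) and close = assms(12,13)
  have fin: "finite R" using assms(1) by (simp add: reward_set_def)
  obtain K L where K: "\<forall>h\<in>histories R. \<forall>a. \<bar>Q h a\<bar> \<le> K" and L: "\<forall>h\<in>histories R. \<bar>V h\<bar> \<le> L"
    by (rule value_functions_boundedE[OF val]) (rule that)
  let ?d = "\<lambda>h. \<bar>V h - v (f h)\<bar>"
  define W where "W = (SUP h\<in>histories R. ?d h)"
  \<comment> \<open>A real supremum is informative only for a bounded set. \<open>V\<close> is
    bounded, and \<open>v\<close> has finitely many values, so the sum of their absolute values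
    bounds each.\<close>
  have bdd: "bdd_above (?d ` histories R)"
  proof (rule bdd_aboveI2)
    fix h :: "('a, 'o) history"
    assume "h \<in> histories R"
    moreover have "\<bar>v (f h)\<bar> \<le> (\<Sum>s\<in>UNIV. \<bar>v s\<bar>)" by (intro member_le_sum) auto
    ultimately show "?d h \<le> L + (\<Sum>s\<in>UNIV. \<bar>v s\<bar>)" using L by force
  qed
  \<comment> \<open>The empty history shows that the supremum ranges over a nonempty set.\<close>
  have nil: "([] :: ('a, 'o) history) \<in> histories R" by (simp add: histories_def)
  have W: "?d h \<le> W" if "h \<in> histories R" for h
    unfolding W_def by (rule cSUP_upper[OF that bdd])
  have W0: "0 \<le> W" using W[OF nil] by linarith
  have diff: "\<bar>B_average R B Q s b - q s b\<bar> \<le> \<gamma> * W" for s b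
    by (rule B_average_surrogate_diff[OF fin gamma(1) val q W0 W])
  have step: "?d h \<le> \<epsilon> + \<epsilon>\<^sub>B + \<gamma> * W" if h: "h \<in> histories R" for h
  proof -
    let ?s = "f h"
    let ?X = "{h' \<in> histories R. f h' = ?s}"
    let ?w = "\<lambda>h. \<P>((h', a', s', b') in B. h' = h) / \<P>((h', a', s', b') in B. s' = ?s)"
    let ?F = "\<lambda>h. \<Sum>a\<in>UNIV. Q h a * lifted_policy B \<pi>\<^sub>R a h ?s"
    let ?A = "\<Sum>b\<in>UNIV. pmf (\<pi>\<^sub>R ?s) b * B_average R B Q ?s b"
    have w: "(?w has_sum 1) ?X" by (rule history_given_state_has_sum[OF hom B])
    \<comment> \<open>\<open>\<epsilon>\<^sub>B\<close> compares with \<open>V\<close> at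
      \<open>h'\<close>, then \<open>\<epsilon>\<close> moves from \<open>h'\<close> to
      \<open>h\<close> within the fibre.\<close>
    have near: "\<bar>?F h' - V h\<bar> \<le> \<epsilon> + \<epsilon>\<^sub>B" if h': "h' \<in> ?X" for h'
    proof -
      have "\<bar>?F h' - V h'\<bar> \<le> \<epsilon>\<^sub>B" using close(2) h' by force
      moreover have "\<bar>V h' - V h\<bar> \<le> \<epsilon>" using close(1) h' h by blast
      ultimately show ?thesis by linarith
    qed
    \<comment> \<open>Closeness to the fixed number \<open>V h\<close> also supplies the uniform
      bound on \<open>?F\<close> that convergence requires.\<close>
    have "\<bar>?F h'\<bar> \<le> \<bar>V h\<bar> + (\<epsilon> + \<epsilon>\<^sub>B)" if "h' \<in> ?X" for h'
      using near[OF that] by linarith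
    then have "\<bar>(\<Sum>\<^sub>\<infinity>h'\<in>?X. ?w h' * ?F h') - (\<Sum>\<^sub>\<infinity>h'\<in>?X. ?w h' * V h)\<bar> \<le> \<epsilon> + \<epsilon>\<^sub>B"
      using eps near has_sum_imp_summable[OF w] infsumI[OF w]
      by (intro weighted_infsum_diff[where K = "\<bar>V h\<bar> + (\<epsilon> + \<epsilon>\<^sub>B)"]) auto
    moreover have "?A = (\<Sum>\<^sub>\<infinity>h'\<in>?X. ?w h' * ?F h')"
      by (rule B_average_policy_sum[OF hom B]) (use K in blast)
    \<comment> \<open>Total weight exactly 1 is essential here: the constant \<open>V h\<close>
      averages to itself.\<close>
    moreover have "(\<Sum>\<^sub>\<infinity>h'\<in>?X. ?w h' * V h) = V h"
      using infsumI[OF has_sum_cmult_left[OF w, of "V h"]] by simp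
    ultimately have "\<bar>?A - V h\<bar> \<le> \<epsilon> + \<epsilon>\<^sub>B" by simp
    moreover have "\<bar>?A - (\<Sum>b\<in>UNIV. pmf (\<pi>\<^sub>R ?s) b * q ?s b)\<bar> \<le> \<gamma> * W"
      using diff gamma W0 by (intro weighted_sum_diff) (auto simp: sum_pmf_le_1)
    moreover have "v ?s = (\<Sum>b\<in>UNIV. pmf (\<pi>\<^sub>R ?s) b * q ?s b)"
      using q unfolding mdp_value_functions_def mult.commute[of "pmf _ _"] by blast
    ultimately show ?thesis by linarith
  qed
  \<comment> \<open>Only the \<open>W\<close> on the left is unfolded, so \<open>step\<close> bounds
    each member of the supremum by a fixed number.\<close>
  have "W \<le> \<epsilon> + \<epsilon>\<^sub>B + \<gamma> * W"
    by (subst W_def, rule cSUP_least) (use nil step in auto)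
  then have W_le: "W \<le> (\<epsilon> + \<epsilon>\<^sub>B) / (1 - \<gamma>)"
    using gamma by (simp add: pos_le_divide_eq algebra_simps)
  \<comment> \<open>The gap between \<open>B_average\<close> and \<open>q\<close> is at most
    \<open>\<gamma> * W\<close>, which accounts for the extra \<open>\<gamma>\<close> in the first
    bound.\<close>
  then have gW_le: "\<gamma> * W \<le> \<gamma> * (\<epsilon> + \<epsilon>\<^sub>B) / (1 - \<gamma>)"
    using mult_left_mono[OF W_le gamma(1)] by simp
  show ?thesis
    using order_trans[OF diff gW_le] order_trans[OF W W_le] by auto
qed

end
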